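(* Let $M$ and $N$ be closed convex subsets of $\hat{\mathbb{R}}$. Then the $\mathcal{H}$-class $R_M \cap L_N$ contains an idempotent if and only if one of the following conditions holds: (i) $M=\{x\}$ and $N=\{y\}$ with $\{x,y\} \neq \{-\infty,\infty\}$; (ii) $M = -N = \{-x \mid x \in N\}$ where $|N| \neq 1$.
   Context: $\bar{\mathbb{R}} = \mathbb{R} \cup \{-\infty\}$ is the tropical semiring with $a \otimes b = a+b$ (with $-\infty$ absorbing) and $a \oplus b = \max\{a,b\}$. $M_2(\bar{\mathbb{R}})$ is the monoid of $2 \times 2$ matrices over $\bar{\mathbb{R}}$ under tropical matrix multiplication $(AB)_{ij} = \max_{k} (A_{ik} + B_{kj})$. The column space $C(A)$ (respectively row space $R(A)$) is the set of all tropical linear combinations in $\bar{\mathbb{R}}^2$ of the columns (respectively rows) of $A$. Let $\hat{\mathbb{R}} = \mathbb{R} \cup \{-\infty,\infty\}$ with the obvious order, and with negation extended by $-(\infty)=-\infty$, $-(-\infty)=\infty$. Each non-zero vector $(a,b) \in \bar{\mathbb{R}}^2$ (i.e. $(a,b)\neq(-\infty,-\infty)$) is projected to the point of $\hat{\mathbb{R}}$ equal to $b-a$ if $a,b$ are real, $\infty$ if $a=-\infty$, and $-\infty$ if $b=-\infty$. $PC(A), PR(A) \subseteq \hat{\mathbb{R}}$ are the images under this projection of the non-zero vectors of $C(A)$ and $R(A)$ respectively. The closed convex subsets of $\hat{\mathbb{R}}$ are the empty set, the singletons, and the closed intervals $[x,y]$ with $x<y$ in $\hat{\mathbb{R}}$.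 For such $M$ and $N$, $R_M = \{A \in M_2(\bar{\mathbb{R}}) : PC(A)=M\}$ and $L_N = \{A \in M_2(\bar{\mathbb{R}}) : PR(A)=N\}$; these are respectively an $\mathcal{R}$-class and an $\mathcal{L}$-class, where $A\mathcal{R}B$ (resp. $A\mathcal{L}B$) means that $A$ and $B$ generate the same principal right (resp. left) ideal. $\mathcal{H} = \mathcal{L}\cap\mathcal{R}$, so $R_M\cap L_N$ is an $\mathcal{H}$-class whenever it is non-empty (if it is empty, it contains no idempotent). An idempotent is a matrix $E$ with $E^2=E$. *)

theory Defs
  imports "HOL-Analysis.Finite_Cartesian_Product" "HOL-Library.Extended_Real"
begin

text \<open>
  The tropical semiring: \<open>+\<close> is the maximum, \<open>*\<close> is the addition of reals, the
  semiring zero is \<open>-\<infinity>\<close> and the semiring one is the real number 0. Hence \<open>**\<close> on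
  \<open>tropical ^ 2 ^ 2\<close> is tropical matrix multiplication.
\<close>

typedef tropical = "{x :: ereal. x \<noteq> \<infinity>}"
  morphisms ereal_of_tropical Tropical
  by (rule exI[of _ 0]) simp

setup_lifting type_definition_tropical

instantiation tropical :: comm_semiring_1
begin

lift_definition zero_tropical :: tropical is "- \<infinity>" by simp

lift_definition one_tropical :: tropical is 0 by simp

lift_definition plus_tropical :: "tropical \<Rightarrow> tropical \<Rightarrow> tropical" is max
  by (simp add: max_def)

lift_definition times_tropical :: "tropical \<Rightarrow> tropical \<Rightarrow> tropical" is "(+)"
  by (metis mem_Collect_eq plus_ereal.simps ereal_plus_eq_PInfty)

instance
proof
  fix a b c :: tropical
  show "a + b + c = a + (b + c)" by transfer (simp add: max.assoc)
  show "a + b = b + a" by transfer (simp add: max.commute)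
  show "0 + a = a" by transfer simp
  show "a * b * c = a * (b * c)" by transfer (simp add: add.assoc)
  show "a * b = b * a" by transfer (simp add: add.commute)
  show "1 * a = a" by transfer simp
  show "(a + b) * c = a * c + b * c"
    by transfer (auto simp: max_def intro: antisym add_right_mono dest: not_le_imp_less less_imp_le)
  show "0 * a = 0" by transfer simp
  show "a * 0 = 0" by transfer simp
  show "(0 :: tropical) \<noteq> 1" by transfer simp
qed

end

definition column_space :: "tropical ^ 2 ^ 2 \<Rightarrow> (tropical ^ 2) set" where
  "column_space A = range (\<lambda>c :: tropical ^ 2. \<Sum>j\<in>UNIV. c $ j *s column j A)"

definition row_space :: "tropical ^ 2 ^ 2 \<Rightarrow> (tropical ^ 2) set" where
  "row_space A = range (\<lambda>c :: tropical ^ 2. \<Sum>i\<in>UNIV. c $ i *s row i A)"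

text \<open>
  The two-point compactification of the reals is the type \<open>ereal\<close>, with its order
  and its negation. The value of \<open>proj\<close> at the zero vector is immaterial.
\<close>

definition proj :: "tropical ^ 2 \<Rightarrow> ereal" where
  "proj v =
     (if v $ 1 = 0 then \<infinity>
      else if v $ 2 = 0 then - \<infinity>
      else ereal_of_tropical (v $ 2) - ereal_of_tropical (v $ 1))"

definition PC :: "tropical ^ 2 ^ 2 \<Rightarrow> ereal set" where
  "PC A = proj ` (column_space A - {0})"

definition PR :: "tropical ^ 2 ^ 2 \<Rightarrow> ereal set" where
  "PR A = proj ` (row_space A - {0})"

definition closed_convex :: "ereal set \<Rightarrow> bool" where
  "closed_convex M \<longleftrightarrow>
     M = {} \<or> (\<exists>x. M = {x}) \<or> (\<exists>x y. x < y \<and> M = {x..y})"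

definition R_class :: "ereal set \<Rightarrow> (tropical ^ 2 ^ 2) set" where
  "R_class M = {A. PC A = M}"

definition L_class :: "ereal set \<Rightarrow> (tropical ^ 2 ^ 2) set" where
  "L_class N = {A. PR A = N}"

end

theory Submission
  imports Defs "HOL-Analysis.Cartesian_Space"
begin

text \<open>
  The idempotents of \<open>M\<^sub>2\<close> can be listed. Writing \<open>E\<close> as the rows \<open>[a, b]\<close> and \<open>[c, d]\<close>, the
  diagonal entries of \<open>E\<^sup>2 = E\<close> give \<open>a = a\<^sup>2 \<oplus> bc\<close> and \<open>d = d\<^sup>2 \<oplus> bc\<close>, which force each of
  \<open>a\<close> and \<open>d\<close> to be the semiring unit or to equal \<open>bc\<close>. Hence a non-zero idempotent is either an
  outer product \<open>u v\<^sup>T\<close> with \<open>v\<^sup>T u = 1\<close>, or has unit diagonal and \<open>bc \<le> 1\<close>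
  (\<open>tropical_idempotent_cases\<close>).

  Both column and row projections are easy to compute for these matrices. For \<open>u v\<^sup>T\<close> they are the
  points \<open>proj u\<close> and \<open>proj v\<close>; the supports of \<open>u\<close> and \<open>v\<close> meet because \<open>v\<^sup>T u \<noteq> 0\<close>, and this is
  what excludes \<open>{-\<infinity>, \<infinity>}\<close>. For an idempotent with unit diagonal the column space is the set of fixed
  vectors, which is cut out by \<open>c \<otimes> v\<^sub>1 \<le> v\<^sub>2\<close> and \<open>b \<otimes> v\<^sub>2 \<le> v\<^sub>1\<close>, so the column projection
  is \<open>[c, -b]\<close>; transposition exchanges \<open>b\<close> and \<open>c\<close>, so the row projection is \<open>[b, -c]\<close>, its negative.
  Conversely, any \<open>[x, y]\<close> with \<open>x < y\<close> is obtained from \<open>c = x\<close> and \<open>b = -y\<close>, which are elements of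
  the tropical semiring because \<open>x \<noteq> \<infinity>\<close> and \<open>y \<noteq> -\<infinity>\<close>.
\<close>

(* Below, transposition is that of matrices, not the swapping of two elements. *)
hide_const (open) Transposition.transpose
hide_fact (open) Transposition.transpose_def

section \<open>Tropical scalars\<close>

text \<open>The order of the semiring is expressed as \<open>a \<le> b \<longleftrightarrow> a + b = b\<close>.\<close>

lemma tropical_add_eq_right_iff:
  "a + b = b \<longleftrightarrow> ereal_of_tropical a \<le> ereal_of_tropical b"
  by transfer (auto simp: max_def)

lemma tropical_add_self [simp]: "(a :: tropical) + a = a"
  by transfer simp

lemma tropical_mult_eq_0_iff [simp]: "(a :: tropical) * b = 0 \<longleftrightarrow> a = 0 \<or> b = 0"
  by transfer (auto simp: ereal_plus_eq_MInfty)

lemma tropical_add_eq_0_iff [simp]: "(a :: tropical) + b = 0 \<longleftrightarrow> a = 0 \<and> b = 0"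
  by transfer (auto simp: max_def)

lemma ereal_of_tropical_neq_PInf [simp]: "ereal_of_tropical a \<noteq> \<infinity>"
  using ereal_of_tropical[of a] by simp

lemma ereal_of_tropical_0 [simp]: "ereal_of_tropical 0 = - \<infinity>"
  by (rule zero_tropical.rep_eq)

lemma ereal_of_tropical_eq_MInf_iff [simp]: "ereal_of_tropical a = - \<infinity> \<longleftrightarrow> a = 0"
  by transfer simp

text \<open>
  Diagonal entries of an idempotent satisfy the hypothesis with \<open>e = bc\<close>. If \<open>a\<close> is positive then
  \<open>a\<^sup>2 > a\<close>; if it is negative and finite then \<open>a\<^sup>2 < a\<close>, so the maximum is \<open>e\<close>.
\<close>

lemma tropical_square_add_eq_self:
  assumes "a * a + e = (a :: tropical)"
  shows "a = 1 \<or> a = e" and "a + 1 = 1" and "e + a = a"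
proof -
  have "(a = 1 \<or> a = e) \<and> a + 1 = 1 \<and> e + a = a"
    using assms
  proof (transfer, goal_cases)
    case (1 a e)
    then show ?case
      by (cases a; cases e) (auto simp: max_def split: if_splits)
  qed
  then show "a = 1 \<or> a = e" and "a + 1 = 1" and "e + a = a"
    by auto
qed

text \<open>Non-zero scalars are real numbers, hence cancellable: only \<open>0\<close> is fixed by a factor other than \<open>1\<close>.\<close>

lemma tropical_mult_eq_self_imp_0:
  fixes s b :: tropical
  assumes "s * b = b" and "s \<noteq> 1"
  shows "b = 0"
  using assms
proof (transfer, goal_cases)
  case (1 s b)
  then show ?case by (cases s; cases b) auto
qed

lemma tropical_mult_le_1_iff:
  "b * c + 1 = (1 :: tropical) \<longleftrightarrow> ereal_of_tropical c \<le> - ereal_of_tropical b"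
proof (transfer, goal_cases)
  case (1 b c)
  then show ?case by (cases b; cases c) (auto simp: max_def)
qed

lemma tropical_mult_inverse_exists:
  assumes "(a :: tropical) \<noteq> 0"
  obtains b where "b * a = 1"
proof -
  have "\<exists>b. b * a = 1"
    using assms
  proof (transfer, goal_cases)
    case (1 a)
    then show ?case by (intro bexI[of _ "- a"]) (cases a; auto)+
  qed
  with that show ?thesis by blast
qed

section \<open>Projective coordinates\<close>

lemma vec2_neq_0_iff: "(v :: tropical ^ 2) \<noteq> 0 \<longleftrightarrow> v $ 1 \<noteq> 0 \<or> v $ 2 \<noteq> 0"
  by (simp add: vec_eq_iff forall_2)

lemma proj_eq_PInf_iff: "proj v = \<infinity> \<longleftrightarrow> v $ 1 = 0"
  by (cases "ereal_of_tropical (v $ 1)"; cases "ereal_of_tropical (v $ 2)")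
     (auto simp: proj_def)

lemma proj_eq_MInf_iff: "proj v = - \<infinity> \<longleftrightarrow> v $ 1 \<noteq> 0 \<and> v $ 2 = 0"
  by (cases "ereal_of_tropical (v $ 1)"; cases "ereal_of_tropical (v $ 2)")
     (auto simp: proj_def)

lemma proj_smult:
  assumes "k \<noteq> 0"
  shows "proj (k *s v) = proj v"
proof (cases "v $ 1 = 0 \<or> v $ 2 = 0")
  case True
  with assms show ?thesis by (auto simp: proj_def)
next
  case False
  with assms have "ereal_of_tropical k \<noteq> - \<infinity>" "ereal_of_tropical (v $ 1) \<noteq> - \<infinity>"
    "ereal_of_tropical (v $ 2) \<noteq> - \<infinity>"
    by simp_all
  with False assms show ?thesis
    by (cases "ereal_of_tropical k"; cases "ereal_of_tropical (v $ 1)";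
        cases "ereal_of_tropical (v $ 2)")
       (auto simp: proj_def times_tropical.rep_eq)
qed

lemma proj_surj_nonzero:
  obtains v where "v \<noteq> 0" and "proj v = z"
proof (cases "z = \<infinity>")
  case True
  show ?thesis
    by (rule that[of "vector [0, 1]"]) (simp_all add: vec2_neq_0_iff proj_def True)
next
  case False
  define t where "t = Tropical z"
  have t: "ereal_of_tropical t = z"
    using False by (simp add: t_def Tropical_inverse)
  show ?thesis
    by (rule that[of "vector [1, t]"])
       (auto simp: vec2_neq_0_iff proj_def t[symmetric] one_tropical.rep_eq)
qed

text \<open>
  Comparing a projective coordinate with a bound is a linear condition on the vector. For real
  entries these are the equivalences \<open>v\<^sub>2 - v\<^sub>1 \<ge> c \<longleftrightarrow> c + v\<^sub>1 \<le> v\<^sub>2\<close> and \<open>v\<^sub>2 - v\<^sub>1 \<le> -b \<longleftrightarrow> b + v\<^sub>2 \<le> v\<^sub>1\<close> in ordinary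
  arithmetic; the values of \<open>proj\<close> at infinity make them persist for infinite entries.
\<close>

lemma le_proj_iff:
  assumes "v \<noteq> 0"
  shows "ereal_of_tropical c \<le> proj v \<longleftrightarrow> c * v $ 1 + v $ 2 = v $ 2"
  using assms
  by (cases "ereal_of_tropical c"; cases "ereal_of_tropical (v $ 1)";
      cases "ereal_of_tropical (v $ 2)")
     (auto simp: proj_def vec2_neq_0_iff tropical_add_eq_right_iff times_tropical.rep_eq
       le_diff_eq)

lemma proj_le_uminus_iff:
  assumes "v \<noteq> 0"
  shows "proj v \<le> - ereal_of_tropical b \<longleftrightarrow> b * v $ 2 + v $ 1 = v $ 1"
  using assms
  by (cases "ereal_of_tropical b"; cases "ereal_of_tropical (v $ 1)";
      cases "ereal_of_tropical (v $ 2)")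
     (auto simp: proj_def vec2_neq_0_iff tropical_add_eq_right_iff times_tropical.rep_eq)

section \<open>Column and row spaces\<close>

lemma column_space_eq_range: "column_space A = range ((*v) A)"
  by (simp add: column_space_def matrix_mult_sum[abs_def])

lemma PR_eq_PC_transpose: "PR A = PC (transpose A)"
  by (simp add: PR_def PC_def row_space_def column_space_def)

lemma column_space_idempotent:
  assumes "E ** E = E"
  shows "column_space E = {v. E *v v = v}"
proof -
  have "E *v (E *v w) = E *v w" for w
    by (simp add: matrix_vector_mul_assoc assms)
  then show ?thesis
    unfolding column_space_eq_range by (metis (mono_tags, lifting) UNIV_I image_iff mem_Collect_eq
        subsetI subset_antisym imageE)
qed

lemma PC_zero: "PC 0 = {}"
  by (auto simp: PC_def column_space_eq_range matrix_vector_mult_def vec_eq_iff)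

definition outer_product :: "tropical ^ 2 \<Rightarrow> tropical ^ 2 \<Rightarrow> tropical ^ 2 ^ 2" where
  "outer_product u v = (\<chi> i j. u $ i * v $ j)"

lemma transpose_outer_product: "transpose (outer_product u v) = outer_product v u"
  by (simp add: outer_product_def transpose_def vec_eq_iff mult.commute)

lemma outer_product_mult_vec:
  "outer_product u v *v w = (v $ 1 * w $ 1 + v $ 2 * w $ 2) *s u"
  by (simp add: outer_product_def matrix_vector_mult_def vec_eq_iff sum_2 algebra_simps)

text \<open>Every column of \<open>u v\<^sup>T\<close> is a multiple of \<open>u\<close>, and scaling does not change the projection.\<close>

lemma PC_outer_product:
  assumes "u \<noteq> 0" and "v \<noteq> 0"
  shows "PC (outer_product u v) = {proj u}"
proof
  show "PC (outer_product u v) \<subseteq> {proj u}"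
    by (auto simp: PC_def column_space_eq_range outer_product_mult_vec intro!: proj_smult)
  let ?k = "v $ 1 * 1 + v $ 2 * 1"
  have k: "?k \<noteq> 0"
    using assms(2) by (simp add: vec2_neq_0_iff)
  have "?k *s u \<in> column_space (outer_product u v)"
    unfolding column_space_eq_range by (rule image_eqI[of _ _ 1]) (simp_all add: outer_product_mult_vec)
  moreover have "?k *s u \<noteq> 0"
    using k assms(1) by (simp add: vec2_neq_0_iff)
  ultimately have "proj (?k *s u) \<in> PC (outer_product u v)"
    unfolding PC_def by blast
  with k show "{proj u} \<subseteq> PC (outer_product u v)"
    by (simp only: proj_smult[OF k]) blast
qed

definition unit_diag :: "tropical \<Rightarrow> tropical \<Rightarrow> tropical ^ 2 ^ 2" where
  "unit_diag b c = vector [vector [1, b], vector [c, 1]]"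

lemma transpose_unit_diag: "transpose (unit_diag b c) = unit_diag c b"
  by (simp add: unit_diag_def transpose_def vec_eq_iff forall_2)

lemma unit_diag_mult_vec:
  "unit_diag b c *v v = v \<longleftrightarrow> b * v $ 2 + v $ 1 = v $ 1 \<and> c * v $ 1 + v $ 2 = v $ 2"
  by (simp add: unit_diag_def matrix_vector_mult_def vec_eq_iff forall_2 sum_2 add.commute)

lemma unit_diag_idempotent:
  assumes "b * c + 1 = 1"
  shows "unit_diag b c ** unit_diag b c = unit_diag b c"
  using assms
  by (simp add: unit_diag_def matrix_matrix_mult_def vec_eq_iff forall_2 sum_2 ac_simps)

text \<open>
  The column space consists of the fixed vectors, and for a unit diagonal being fixed means
  precisely that the projective coordinate lies between \<open>c\<close> and \<open>-b\<close>.
\<close>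

lemma PC_unit_diag:
  assumes "b * c + 1 = 1"
  shows "PC (unit_diag b c) = {ereal_of_tropical c .. - ereal_of_tropical b}"
proof -
  have fixed_iff: "unit_diag b c *v v = v \<longleftrightarrow>
      proj v \<in> {ereal_of_tropical c .. - ereal_of_tropical b}" if "v \<noteq> 0" for v
    using that by (auto simp: unit_diag_mult_vec le_proj_iff proj_le_uminus_iff)
  have "PC (unit_diag b c) = proj ` {v. v \<noteq> 0 \<and> unit_diag b c *v v = v}"
    unfolding PC_def column_space_idempotent[OF unit_diag_idempotent[OF assms]]
    by (rule arg_cong[where f = "image proj"]) auto
  also have "\<dots> = proj ` {v. v \<noteq> 0 \<and> proj v \<in> {ereal_of_tropical c .. - ereal_of_tropical b}}"
    using fixed_iff by (intro arg_cong[where f = "image proj"]) blast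
  also have "\<dots> = {ereal_of_tropical c .. - ereal_of_tropical b}"
    by (auto elim: proj_surj_nonzero) (metis (mono_tags, lifting) atLeastAtMost_iff image_eqI
        mem_Collect_eq proj_surj_nonzero)
  finally show ?thesis .
qed

lemma PR_unit_diag:
  assumes "b * c + 1 = 1"
  shows "PR (unit_diag b c) = {ereal_of_tropical b .. - ereal_of_tropical c}"
  using PC_unit_diag[of c b] assms
  by (simp add: PR_eq_PC_transpose transpose_unit_diag mult.commute)

section \<open>Idempotents\<close>

lemma outer_product_idempotent:
  assumes "v $ 1 * u $ 1 + v $ 2 * u $ 2 = 1"
  shows "outer_product u v ** outer_product u v = outer_product u v"
proof -
  have "(outer_product u v ** outer_product u v) $ i $ j =
      (v $ 1 * u $ 1 + v $ 2 * u $ 2) * (u $ i * v $ j)" for i j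
    by (simp add: outer_product_def matrix_matrix_mult_def sum_2 algebra_simps)
  with assms show ?thesis
    by (simp add: vec_eq_iff) (simp add: outer_product_def)
qed

text \<open>
  If one diagonal entry is \<open>1\<close> and the other is not, the other is \<open>bc\<close> and the matrix has rank one.
  If neither is \<open>1\<close>, both are below \<open>1\<close>, and \<open>b = (a \<oplus> d) b\<close> forces the off-diagonal
  entries, and with them the diagonal, to vanish.
\<close>

lemma tropical_idempotent_cases:
  assumes "E ** E = (E :: tropical ^ 2 ^ 2)"
  obtains (zero) "E = 0"
  | (rank_one) u v where "v $ 1 * u $ 1 + v $ 2 * u $ 2 = 1" and "E = outer_product u v"
  | (unit_diag) b c where "b * c + 1 = 1" and "E = unit_diag b c"
proof -
  define a b c d where abcd: "a = E $ 1 $ 1" "b = E $ 1 $ 2" "c = E $ 2 $ 1" "d = E $ 2 $ 2"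
  have "(E ** E) $ i $ j = E $ i $ j" for i j
    by (simp add: assms)
  then have entry: "E $ i $ 1 * E $ 1 $ j + E $ i $ 2 * E $ 2 $ j = E $ i $ j" for i j
    by (simp add: matrix_matrix_mult_def sum_2)
  have eqs: "a * a + b * c = a" "a * b + b * d = b" "c * a + d * c = c" "d * d + b * c = d"
    using entry[of 1 1] entry[of 1 2] entry[of 2 1] entry[of 2 2]
    by (simp_all add: abcd ac_simps)
  note a = tropical_square_add_eq_self[OF eqs(1)]
  note d = tropical_square_add_eq_self[OF eqs(4)]
  show ?thesis
  proof (cases "a = 1"; cases "d = 1")
    assume "a = 1" "d = 1"
    then have "E = unit_diag b c"
      by (simp add: abcd unit_diag_def vec_eq_iff forall_2)
    moreover have "b * c + 1 = 1"
      using a(3) \<open>a = 1\<close> by simp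
    ultimately show ?thesis
      using unit_diag by blast
  next
    assume "a = 1" "d \<noteq> 1"
    with d have "d = b * c" by blast
    with \<open>a = 1\<close> have "E = outer_product (vector [1, c]) (vector [1, b])"
      by (simp add: abcd outer_product_def vec_eq_iff forall_2 ac_simps)
    moreover have "1 + b * c = 1"
      using a(3) \<open>a = 1\<close> by (simp add: add.commute)
    ultimately show ?thesis
      by (intro rank_one[of "vector [1, b]" "vector [1, c]"]) simp_all
  next
    assume "a \<noteq> 1" "d = 1"
    with a have "a = b * c" by blast
    with \<open>d = 1\<close> have "E = outer_product (vector [b, 1]) (vector [c, 1])"
      by (simp add: abcd outer_product_def vec_eq_iff forall_2 ac_simps)
    moreover have "c * b + 1 = 1"
      using d(3) \<open>d = 1\<close> by (simp add: mult.commute)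
    ultimately show ?thesis
      by (intro rank_one[of "vector [c, 1]" "vector [b, 1]"]) simp_all
  next
    assume ne: "a \<noteq> 1" "d \<noteq> 1"
    with a d have "a = d" by simp
    with eqs have "a * b = b" "a * c = c"
      by (simp_all add: ac_simps)
    with ne have "b = 0" "c = 0"
      by (auto intro: tropical_mult_eq_self_imp_0)
    with ne a d have "E = 0"
      by (simp add: abcd vec_eq_iff forall_2)
    with zero show ?thesis .
  qed
qed

lemma ereal_uminus_image_atLeastAtMost: "uminus ` {x..y :: ereal} = {- y..- x}"
proof
  show "{- y..- x} \<subseteq> uminus ` {x..y}"
  proof
    fix z assume "z \<in> {- y..- x}"
    then show "z \<in> uminus ` {x..y}"
      by (intro image_eqI[of _ _ "- z"])
         (auto simp: ereal_uminus_le_reorder, metis ereal_minus_le_minus ereal_uminus_uminus)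
  qed
qed auto

text \<open>
  Two points are projections of vectors with scalar product \<open>1\<close> as soon as the supports of the
  vectors meet: the scalar product is then invertible, and one vector can be rescaled.
\<close>

lemma idempotent_with_singleton_projections:
  assumes "{x, y} \<noteq> {- \<infinity>, \<infinity>}"
  obtains E where "E ** E = E" and "PC E = {x}" and "PR E = {y}"
proof -
  obtain u where u: "u \<noteq> 0" "proj u = x" by (rule proj_surj_nonzero)
  obtain w where w: "w \<noteq> 0" "proj w = y" by (rule proj_surj_nonzero)
  have "w $ 1 * u $ 1 + w $ 2 * u $ 2 \<noteq> 0"
    using assms u w proj_eq_PInf_iff[of u] proj_eq_PInf_iff[of w]
      proj_eq_MInf_iff[of u] proj_eq_MInf_iff[of w]
    by (auto simp: vec2_neq_0_iff)
  then obtain k where k: "k * (w $ 1 * u $ 1 + w $ 2 * u $ 2) = 1"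
    by (rule tropical_mult_inverse_exists)
  then have "k \<noteq> 0" by auto
  define v where "v = k *s w"
  have v: "v \<noteq> 0" "proj v = y"
    using w \<open>k \<noteq> 0\<close> by (auto simp: v_def proj_smult vec2_neq_0_iff)
  have "v $ 1 * u $ 1 + v $ 2 * u $ 2 = 1"
    using k by (simp add: v_def algebra_simps)
  with u v show ?thesis
    by (intro that[of "outer_product u v"])
       (simp_all add: outer_product_idempotent PR_eq_PC_transpose transpose_outer_product
         PC_outer_product)
qed

lemma idempotent_with_opposite_interval_projections:
  assumes "x < y"
  obtains E where "E ** E = E" and "PC E = {x..y}" and "PR E = {- y..- x}"
proof -
  define b c where "b = Tropical (- y)" and "c = Tropical x"
  have bc: "ereal_of_tropical b = - y" "ereal_of_tropical c = x"
    unfolding b_def c_def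
    by (rule Tropical_inverse; use assms in \<open>force simp: ereal_uminus_eq_reorder\<close>)+
  then have "b * c + 1 = 1"
    using assms by (simp add: tropical_mult_le_1_iff)
  with bc show ?thesis
    by (intro that[of "unit_diag b c"])
       (simp_all add: unit_diag_idempotent PC_unit_diag PR_unit_diag)
qed

lemma idempotent_projections:
  assumes "E ** E = E"
  shows "(\<exists>x y. PC E = {x} \<and> PR E = {y} \<and> {x, y} \<noteq> {- \<infinity>, \<infinity>}) \<or>
    (PC E = uminus ` PR E \<and> \<not> is_singleton (PR E))"
  using assms
proof (cases rule: tropical_idempotent_cases)
  case zero
  have "transpose (0 :: tropical ^ 2 ^ 2) = 0"
    by (simp add: transpose_def vec_eq_iff)
  then show ?thesis
    by (simp add: zero PR_eq_PC_transpose PC_zero is_singleton_def)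
next
  case (rank_one u v)
  then have nz: "u \<noteq> 0" "v \<noteq> 0" by auto
  \<comment> \<open>Opposite infinite projections would mean disjoint supports.\<close>
  have "{proj u, proj v} \<noteq> {- \<infinity>, \<infinity>}"
    using rank_one(1) proj_eq_PInf_iff[of u] proj_eq_PInf_iff[of v]
      proj_eq_MInf_iff[of u] proj_eq_MInf_iff[of v]
    by (auto simp: doubleton_eq_iff)
  with nz show ?thesis
    by (simp add: rank_one PR_eq_PC_transpose transpose_outer_product PC_outer_product)
next
  case (unit_diag b c)
  let ?b = "ereal_of_tropical b" and ?c = "ereal_of_tropical c"
  have PC: "PC E = {?c..- ?b}" and PR: "PR E = {?b..- ?c}"
    by (simp_all add: unit_diag PC_unit_diag PR_unit_diag)
  have opposite: "PC E = uminus ` PR E"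
    by (simp add: PC PR ereal_uminus_image_atLeastAtMost)
  show ?thesis
  proof (cases "is_singleton (PR E)")
    case True
    \<comment> \<open>The interval has shrunk to a point, which is finite since neither \<open>b\<close> nor \<open>c\<close> is \<open>\<infinity>\<close>.\<close>
    then obtain y where y: "{?b..- ?c} = {y}"
      by (auto simp: is_singleton_def PR)
    then have "?b = y" "- ?c = y"
      by (simp_all add: atLeastAtMost_singleton_iff)
    then have "y \<noteq> \<infinity>" "y \<noteq> - \<infinity>"
      by (auto simp: ereal_uminus_eq_reorder)
    then have "{- y, y} \<noteq> {- \<infinity>, \<infinity>}"
      by (auto simp: doubleton_eq_iff)
    moreover have "PC E = {- y}"
      using opposite y by (simp add: PR)
    ultimately show ?thesis
      using y PR by blast
  next
    case False
    with opposite show ?thesis by blast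
  qed
qed

theorem theorem4p3:
  fixes M N :: "ereal set"
  assumes "closed_convex M" and "closed_convex N"
  shows "(\<exists>E \<in> R_class M \<inter> L_class N. E ** E = E) \<longleftrightarrow>
    (\<exists>x y. M = {x} \<and> N = {y} \<and> {x, y} \<noteq> {- \<infinity>, \<infinity>}) \<or>
    (M = uminus ` N \<and> \<not> is_singleton N)"
proof
  assume "\<exists>E \<in> R_class M \<inter> L_class N. E ** E = E"
  then show "(\<exists>x y. M = {x} \<and> N = {y} \<and> {x, y} \<noteq> {- \<infinity>, \<infinity>}) \<or>
      (M = uminus ` N \<and> \<not> is_singleton N)"
    unfolding R_class_def L_class_def using idempotent_projections by blast
next
  assume "(\<exists>x y. M = {x} \<and> N = {y} \<and> {x, y} \<noteq> {- \<infinity>, \<infinity>}) \<or>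
      (M = uminus ` N \<and> \<not> is_singleton N)"
  then have "\<exists>E. E ** E = E \<and> PC E = M \<and> PR E = N"
  proof
    assume "\<exists>x y. M = {x} \<and> N = {y} \<and> {x, y} \<noteq> {- \<infinity>, \<infinity>}"
    then show ?thesis
      by (metis idempotent_with_singleton_projections)
  next
    assume *: "M = uminus ` N \<and> \<not> is_singleton N"
    with assms(2) consider "N = {}" | x y where "x < y" "N = {x..y}"
      by (auto simp: closed_convex_def)
    then show ?thesis
    proof cases
      case 1
      have "transpose (0 :: tropical ^ 2 ^ 2) = 0" "(0 :: tropical ^ 2 ^ 2) ** 0 = 0"
        by (simp_all add: transpose_def matrix_matrix_mult_def vec_eq_iff)
      with 1 * show ?thesis
        by (intro exI[of _ 0]) (simp add: PR_eq_PC_transpose PC_zero)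
    next
      case (2 x y)
      then have "- y < - x" by simp
      then obtain E where "E ** E = E" "PC E = {- y..- x}" "PR E = {- (- x)..- (- y)}"
        by (rule idempotent_with_opposite_interval_projections)
      with 2 * show ?thesis
        by (intro exI[of _ E]) (simp add: ereal_uminus_image_atLeastAtMost)
    qed
  qed
  then show "\<exists>E \<in> R_class M \<inter> L_class N. E ** E = E"
    by (auto simp: R_class_def L_class_def)
qed

end
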